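(* Let $a,r,h,g$ be positive integers with $ga+h<gr$, and put $n=rg$. Then there exists an MR $(n,r,h,a)$-LRC over a field of size \[\ell\le\left(\max\left\{\tilde O\!\left(\tfrac nr\right),\ (2r)^{h+a}\right\}\right)^{\min\{h,\frac nr\}}.\]
   Context: $\tilde O(f)$ denotes $f\cdot(\log f)^{O(1)}$. Definition: let $\ell$ be a prime power, $a,g,r,h$ positive integers with $ga+h<gr$, $n=gr$, $k=n-ga-h$. An MR (maximally recoverable) $(n,r,h,a)_\ell$-LRC is an $[n,k]$ linear code over $\mathbb{F}_\ell$ with a parity-check matrix $H$ of the block form whose first $ga$ rows are block diagonal with diagonal blocks $A_1,\dots,A_g$ (each $a\times r$, coordinates split into $g$ consecutive groups of size $r$) and whose last $h$ rows are $(D_1|\cdots|D_g)$ with each $D_i$ of size $h\times r$, such that (i) each $A_i$ generates an $[r,a,r-a+1]_\ell$ MDS code, and (ii) every set of $ag+h$ columns of $H$ consisting of any $a$ columns from each group together with any $h$ further columns is linearly independent over $\mathbb{F}_\ell$. "Over a field of size $\ell$" means an MR $(n,r,h,a)_\ell$-LRC. *)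

theory Defs
  imports Complex_Main "HOL-Algebra.Ring"
begin

definition lin_indep :: "('a, 'b) ring_scheme \<Rightarrow> nat set \<Rightarrow> nat set \<Rightarrow> (nat \<Rightarrow> nat \<Rightarrow> 'a) \<Rightarrow> bool" where
  "lin_indep R I J v \<longleftrightarrow>
     (\<forall>co \<in> I \<rightarrow> carrier R.
        (\<forall>j\<in>J. finsum R (\<lambda>i. co i \<otimes>\<^bsub>R\<^esub> v i j) I = \<zero>\<^bsub>R\<^esub>) \<longrightarrow> (\<forall>i\<in>I. co i = \<zero>\<^bsub>R\<^esub>))"

text \<open>The a x r matrix A (entries A k c, k < a, c < r) generates an [r,a,r-a+1] MDS code:
  its rows are independent (dimension a) and every nonzero codeword has weight at least r-a+1
  (by the Singleton bound the minimum distance is then exactly r-a+1).\<close>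
definition MDS_gen :: "('a, 'b) ring_scheme \<Rightarrow> nat \<Rightarrow> nat \<Rightarrow> (nat \<Rightarrow> nat \<Rightarrow> 'a) \<Rightarrow> bool" where
  "MDS_gen R a r A \<longleftrightarrow>
     (\<forall>k<a. \<forall>c<r. A k c \<in> carrier R) \<and>
     lin_indep R {..<a} {..<r} A \<and>
     (\<forall>co \<in> {..<a} \<rightarrow> carrier R. (\<exists>k<a. co k \<noteq> \<zero>\<^bsub>R\<^esub>) \<longrightarrow>
        r - a + 1 \<le> card {c. c < r \<and> finsum R (\<lambda>k. co k \<otimes>\<^bsub>R\<^esub> A k c) {..<a} \<noteq> \<zero>\<^bsub>R\<^esub>})"

text \<open>H (entries H i j, rows i < g*a+h, columns j < n, g = n div r) is a parity-check matrix
  of an MR (n,r,h,a)-LRC over R. Columns are split into g consecutive groups of size r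
  (column j lies in group j div r); the first g*a rows are block diagonal with blocks A_b
  (rows b*a..b*a+a-1, columns b*r..b*r+r-1).\<close>
definition MR_LRC :: "('a, 'b) ring_scheme \<Rightarrow> nat \<Rightarrow> nat \<Rightarrow> nat \<Rightarrow> nat \<Rightarrow> (nat \<Rightarrow> nat \<Rightarrow> 'a) \<Rightarrow> bool" where
  "MR_LRC R n r h a H \<longleftrightarrow>
     (let g = n div r in
       r dvd n \<and>
       (\<forall>i < g*a+h. \<forall>j < n. H i j \<in> carrier R) \<and>
       (\<forall>i < g*a. \<forall>j < n. j div r \<noteq> i div a \<longrightarrow> H i j = \<zero>\<^bsub>R\<^esub>) \<and>
       lin_indep R {..<g*a+h} {..<n} H \<and>
       (\<forall>b < g. MDS_gen R a r (\<lambda>k c. H (b*a+k) (b*r+c))) \<and>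
       (\<forall>S \<subseteq> {..<n}. card S = g*a+h \<and> (\<forall>b<g. a \<le> card {j\<in>S. j div r = b}) \<longrightarrow>
            lin_indep R S {..<g*a+h} (\<lambda>j i. H i j)))"

end

theory Submission
  imports Defs "HOL-Algebra.Algebraic_Closure_Type"
begin

text \<open>The code is a linearized Reed-Solomon code (Martinez-Penas and Kschischang; Gopi and Guruswami).
  Let \<open>q\<close> be the least power of 2 with \<open>q \<ge> max r (g + 1)\<close>, and let \<open>F \<subseteq> K\<close> be the fields with
  \<open>q\<close> and \<open>q\<^sup>h\<close> elements. Every \<open>A\<^sub>b\<close> is the Vandermonde matrix of distinct points \<open>x\<^sub>0, \<dots>, x\<^bsub>r-1\<^esub>\<close> of
  \<open>F\<close>. The rows of \<open>D\<^sub>b\<close> are \<open>\<phi>\<^sub>b\<^sup>s(\<beta>)\<close> for \<open>s < h\<close>, where \<open>\<phi>\<^sub>b(u) = \<gamma>\<^sub>b u\<^sup>q\<close>, the \<open>\<gamma>\<^sub>b \<in> K\<close> have distinct norms in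
  \<open>F\<close>, and \<open>\<beta>\<^sub>c\<close> has the coordinates \<open>x\<^sub>c\<^sup>a, \<dots>, x\<^sub>c\<^bsup>a+h-1\<^esup>\<close> in a basis of \<open>K\<close> over \<open>F\<close>. Eliminating \<open>a\<close>
  columns per group by Lagrange interpolation, which has coefficients in \<open>F\<close> and therefore commutes with
  \<open>\<phi>\<^sub>b\<close>, leaves a skew Moore matrix whose columns are independent because those in one
  group come from elements that are independent over \<open>F\<close>.
  Since \<open>q \<le> max (2r) (4g)\<close>, the size \<open>q\<^sup>h\<close> is small enough without any logarithmic factor: for \<open>h \<le> g\<close>
  this is immediate, and for \<open>g < h\<close> one has \<open>q \<le> (2r)\<^sup>g\<close>, so \<open>q\<^sup>h \<le> ((2r)\<^sup>h)\<^sup>g\<close>.\<close>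

section \<open>Finite subfields\<close>

text \<open>The subfields depend on the parameters of the code, so they are sets inside one fixed
  field type instead of types of their own.\<close>

locale field_subset =
  fixes K :: "'a::Fields.field set"
  assumes one_closed: "1 \<in> K"
    and diff_closed: "x \<in> K \<Longrightarrow> y \<in> K \<Longrightarrow> x - y \<in> K"
    and mult_closed: "x \<in> K \<Longrightarrow> y \<in> K \<Longrightarrow> x * y \<in> K"
    and inverse_closed: "x \<in> K \<Longrightarrow> inverse x \<in> K"
begin

lemma zero_closed: "0 \<in> K"
  using diff_closed[OF one_closed one_closed] by simp

lemma uminus_closed: "x \<in> K \<Longrightarrow> - x \<in> K"
  using diff_closed[OF zero_closed, of x] by simp

lemma add_closed: "x \<in> K \<Longrightarrow> y \<in> K \<Longrightarrow> x + y \<in> K"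
  using diff_closed[OF _ uminus_closed, of x y] by simp

lemma divide_closed: "x \<in> K \<Longrightarrow> y \<in> K \<Longrightarrow> x / y \<in> K"
  by (simp add: Fields.field_class.field_divide_inverse mult_closed inverse_closed)

lemma power_closed: "x \<in> K \<Longrightarrow> x ^ n \<in> K"
  by (induction n) (auto intro: one_closed mult_closed)

lemma sum_closed: "(\<And>i. i \<in> I \<Longrightarrow> f i \<in> K) \<Longrightarrow> sum f I \<in> K"
  by (induction I rule: infinite_finite_induct) (auto intro: zero_closed add_closed)

lemma prod_closed: "(\<And>i. i \<in> I \<Longrightarrow> f i \<in> K) \<Longrightarrow> prod f I \<in> K"
  by (induction I rule: infinite_finite_induct) (auto intro: one_closed mult_closed)

lemmas closed = zero_closed one_closed uminus_closed add_closed diff_closed mult_closed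
  inverse_closed divide_closed power_closed sum_closed prod_closed

end

text \<open>The left kernel of a square matrix vanishes if the right one does: an injective linear
  self-map of a finite space is surjective.\<close>

lemma (in field_subset) square_kernel_transpose:
  assumes fin: "finite K" "finite S" "finite I" and card: "card S = card I"
    and v: "\<And>j i. j \<in> S \<Longrightarrow> i \<in> I \<Longrightarrow> v j i \<in> K"
    and inj: "\<And>c. c \<in> S \<rightarrow> K \<Longrightarrow> \<forall>i\<in>I. (\<Sum>j\<in>S. c j * v j i) = 0 \<Longrightarrow> \<forall>j\<in>S. c j = 0"
    and zero: "\<And>j. j \<in> S \<Longrightarrow> (\<Sum>i\<in>I. l i * v j i) = 0"
  shows "\<forall>i\<in>I. l i = 0"
proof
  fix i0 assume i0: "i0 \<in> I"
  define \<Phi> where "\<Phi> c = restrict (\<lambda>i. \<Sum>j\<in>S. c j * v j i) I" for c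
  have img: "\<Phi> ` (S \<rightarrow>\<^sub>E K) \<subseteq> I \<rightarrow>\<^sub>E K"
    unfolding \<Phi>_def by (intro image_subsetI restrict_PiE_iff[THEN iffD2]) (auto intro!: closed v)
  have "inj_on \<Phi> (S \<rightarrow>\<^sub>E K)"
  proof (rule inj_onI)
    fix c d assume cd: "c \<in> S \<rightarrow>\<^sub>E K" "d \<in> S \<rightarrow>\<^sub>E K" and eq: "\<Phi> c = \<Phi> d"
    have "\<forall>j\<in>S. c j - d j = 0"
    proof (rule inj)
      show "(\<lambda>j. c j - d j) \<in> S \<rightarrow> K" using cd by (auto intro!: closed)
      show "\<forall>i\<in>I. (\<Sum>j\<in>S. (c j - d j) * v j i) = 0"
      proof
        fix i assume "i \<in> I"
        then show "(\<Sum>j\<in>S. (c j - d j) * v j i) = 0"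
          using fun_cong[OF eq, of i] by (simp add: \<Phi>_def left_diff_distrib sum_subtractf)
      qed
    qed
    then show "c = d" using cd by (auto intro!: PiE_ext[OF cd])
  qed
  then have "card (\<Phi> ` (S \<rightarrow>\<^sub>E K)) = card (I \<rightarrow>\<^sub>E K)"
    using card fin by (simp add: card_image card_funcsetE)
  then have surj: "\<Phi> ` (S \<rightarrow>\<^sub>E K) = I \<rightarrow>\<^sub>E K"
    using img fin by (intro card_subset_eq) (auto intro: finite_PiE)
  \<comment> \<open>By surjectivity the unit vector at \<open>i0\<close> is a combination of the
    vectors \<open>v j\<close> with coefficients in \<open>K\<close>, and pairing it with
    \<open>l\<close> isolates \<open>l i0\<close>. The values of \<open>l\<close> range over the
    whole field type; only the coefficients \<open>c\<close> are counted.\<close>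
  define e where "e = restrict (\<lambda>i. if i = i0 then 1 else 0 :: 'a) I"
  have "e \<in> I \<rightarrow>\<^sub>E K" unfolding e_def by (auto intro: closed)
  then obtain c where c: "c \<in> S \<rightarrow>\<^sub>E K" "e = \<Phi> c" using surj by blast
  have "l i0 = (\<Sum>i\<in>I. l i * e i)"
    using i0 fin by (simp add: e_def sum.delta if_distrib[of "\<lambda>x. _ * x"] cong: if_cong)
  also have "\<dots> = (\<Sum>i\<in>I. \<Sum>j\<in>S. c j * (l i * v j i))"
    by (intro sum.cong) (auto simp: c(2) \<Phi>_def sum_distrib_left algebra_simps)
  also have "\<dots> = (\<Sum>j\<in>S. c j * (\<Sum>i\<in>I. l i * v j i))"
    by (subst sum.swap) (simp add: sum_distrib_left)
  also have "\<dots> = 0" using zero by simp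
  finally show "l i0 = 0" .
qed

text \<open>Greedy choice: \<open>m < h\<close> elements have at most \<open>card F ^ m\<close>
  combinations over \<open>F\<close>, fewer than \<open>card K\<close>, so some element of
  \<open>K\<close> lies outside their span and extends the family.\<close>

lemma exists_basis:
  fixes F K :: "'a::Fields.field set"
  assumes F: "field_subset F" "finite F" and K: "field_subset K" "finite K"
    and card: "card K = card F ^ h"
  obtains w where "\<And>k. k < h \<Longrightarrow> w k \<in> K"
    and "\<And>c. (\<forall>k<h. c k \<in> F) \<Longrightarrow> (\<Sum>k<h. c k * w k) = 0 \<Longrightarrow> \<forall>k<h. c k = 0"
proof -
  interpret F: field_subset F by fact
  interpret K: field_subset K by fact
  have "card F \<ge> card {0, 1::'a}"
    using F.closed(1,2) F(2) by (intro card_mono) auto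
  then have q: "card F > 1" by simp
  have "\<exists>w. (\<forall>k<m. w k \<in> K) \<and>
      (\<forall>c. (\<forall>k<m. c k \<in> F) \<longrightarrow> (\<Sum>k<m. c k * w k) = 0 \<longrightarrow> (\<forall>k<m. c k = 0))" if "m \<le> h" for m
    using that
  proof (induction m)
    case (Suc m)
    then obtain w where w: "\<And>k. k < m \<Longrightarrow> w k \<in> K"
      "\<And>c. (\<forall>k<m. c k \<in> F) \<Longrightarrow> (\<Sum>k<m. c k * w k) = 0 \<Longrightarrow> (\<forall>k<m. c k = 0)"
      by (metis Suc_leD)
    define V where "V = (\<lambda>c. \<Sum>k<m. c k * w k) ` ({..<m} \<rightarrow>\<^sub>E F)"
    have "card V \<le> card ({..<m} \<rightarrow>\<^sub>E F)"
      unfolding V_def by (intro card_image_le finite_PiE) (auto simp: F)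
    also have "\<dots> = card F ^ m" by (simp add: card_funcsetE)
    also have "\<dots> < card K" using Suc.prems q card by (simp add: power_strict_increasing)
    finally have "\<not> K \<subseteq> V"
      using card_mono[of V K] F(2) by (auto simp: V_def finite_PiE)
    then obtain u where u: "u \<in> K" "u \<notin> V" by blast
    show ?case
    proof (intro exI[of _ "w(m := u)"] conjI allI impI)
      fix k assume "k < Suc m" then show "(w(m := u)) k \<in> K" using w u by auto
    next
      fix c k assume c: "\<forall>k<Suc m. c k \<in> F" and 0: "(\<Sum>k<Suc m. c k * (w(m := u)) k) = 0"
        and k: "k < Suc m"
      have eq: "(\<Sum>k<m. c k * w k) + c m * u = 0" using 0 by simp
      have cm: "c m = 0"
      proof (rule ccontr)
        assume nz: "c m \<noteq> 0"
        have "u = (\<Sum>k<m. restrict (\<lambda>k. - c k / c m) {..<m} k * w k)"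
        proof -
          have "u = - (\<Sum>k<m. c k * w k) / c m" using eq nz by (simp add: field_simps eq_neg_iff_add_eq_0)
          then show ?thesis by (simp add: sum_divide_distrib sum_negf)
        qed
        moreover have "restrict (\<lambda>k. - c k / c m) {..<m} \<in> {..<m} \<rightarrow>\<^sub>E F"
          using c by (auto intro!: F.closed)
        ultimately have "u \<in> V" unfolding V_def by blast
        then show False using u by blast
      qed
      have "\<forall>k<m. c k = 0" by (rule w) (use c eq cm in auto)
      then show "c k = 0" using cm k by (auto simp: less_Suc_eq)
    qed
  qed auto
  from this[of h] that show ?thesis by blast
qed

section \<open>Finite fields as fixed points of power maps\<close>

definition fixed_points :: "nat \<Rightarrow> 'a::Fields.field set" where
  "fixed_points n = {x. x ^ n = x}"

lemma field_subset_fixed_points: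
  assumes "n > 0" and add: "\<And>x y :: 'a::Fields.field. (x + y) ^ n = x ^ n + y ^ n"
  shows "field_subset (fixed_points n :: 'a set)"
proof
  fix x y :: 'a assume xy: "x \<in> fixed_points n" "y \<in> fixed_points n"
  have "(x - y) ^ n = x ^ n - y ^ n" using add[of "x - y" y] by simp
  then show "x - y \<in> fixed_points n" using xy by (simp add: fixed_points_def)
qed (auto simp: fixed_points_def power_mult_distrib power_inverse)

text \<open>The polynomial \<open>X^n - X\<close> splits, and its derivative is the constant -1
  because the characteristic divides \<open>n\<close>. So no root is repeated and there are
  \<open>n\<close> of them.\<close>

lemma card_fixed_points:
  assumes n: "n > 1" and dvd: "CHAR('a::alg_closed_field) dvd n"
  shows "finite (fixed_points n :: 'a set)" "card (fixed_points n :: 'a set) = n"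
proof -
  define p :: "'a poly" where "p = monom 1 n - monom 1 1"
  have deg: "degree p = n"
    unfolding p_def diff_conv_add_uminus using n by (subst degree_add_eq_left) (auto simp: degree_monom_eq)
  have p0: "p \<noteq> 0" using deg n by auto
  have "of_nat n = (0 :: 'a)" using dvd by (simp add: of_nat_eq_0_iff_char_dvd)
  then have pd: "pderiv p = - 1"
    by (simp add: p_def pderiv_diff pderiv_monom monom_0 one_pCons)
  obtain A where A: "size A = degree p" "p = smult (lead_coeff p) (\<Prod>x\<in>#A. [:-x, 1:])"
    using alg_closed_imp_factorization[OF p0] by blast
  have roots: "set_mset A = fixed_points n"
  proof -
    have "x \<in># A \<longleftrightarrow> poly p x = 0" for x
      by (subst A(2)) (use p0 in \<open>auto simp: poly_prod_mset prod_mset_zero_iff image_iff\<close>)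
    then show ?thesis by (auto simp: p_def poly_monom fixed_points_def)
  qed
  have "count A x \<le> 1" for x
  proof (rule ccontr)
    assume "\<not> count A x \<le> 1"
    then have "{#x, x#} \<subseteq># A" by (auto simp: subseteq_mset_def)
    then obtain B where B: "A = {#x, x#} + B" by (metis mset_subset_eq_exists_conv)
    define r where "r = smult (lead_coeff p) (\<Prod>x\<in>#B. [:-x, 1:])"
    have p_eq: "p = [:-x, 1:] * ([:-x, 1:] * r)"
      by (subst A(2), subst B) (simp add: r_def mult_ac)
    have "poly (pderiv p) x = 0"
      unfolding p_eq pderiv_mult poly_add poly_mult by simp
    then show False using pd by simp
  qed
  then have "A = mset_set (set_mset A)"
    by (intro multiset_eqI) (metis count_eq_zero_iff count_mset_set(1,3) finite_set_mset le_neq_implies_less less_one)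
  then have "size A = card (set_mset A)" by (metis size_mset_set)
  then show "card (fixed_points n :: 'a set) = n" using A(1) deg roots by simp
  show "finite (fixed_points n :: 'a set)" using roots[symmetric] by simp
qed

section \<open>Vandermonde systems\<close>

lemma poly_zero_on_card:
  fixes p :: "'a::idom poly"
  assumes "degree p < N" "inj_on x P" "card P \<ge> N" "\<And>i. i \<in> P \<Longrightarrow> poly p (x i) = 0"
  shows "p = 0"
proof (rule ccontr)
  assume p: "p \<noteq> 0"
  have "card P = card (x ` P)" using assms by (simp add: card_image)
  also have "\<dots> \<le> card {z. poly p z = 0}"
    using assms by (intro card_mono poly_roots_finite p) auto
  also have "\<dots> \<le> degree p" by (rule card_poly_roots_bound[OF p])
  finally show False using assms by simp
qed

lemma poly_power_sum:
  fixes c :: "nat \<Rightarrow> 'a::comm_semiring_1"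
  shows "poly (\<Sum>k<N. monom (c k) k) z = (\<Sum>k<N. c k * z ^ k)"
  by (simp add: poly_sum poly_monom)

lemma degree_power_sum_less:
  "N > 0 \<Longrightarrow> degree (\<Sum>k<N. monom (c k) k) < N"
  by (rule le_less_trans[OF degree_sum_le[of _ _ "N - 1"]])
     (auto intro: order_trans[OF degree_monom_le])

text \<open>A combination of rows lists the values of a polynomial of degree below \<open>N\<close>,
  which cannot vanish at \<open>N\<close> distinct points unless it is zero.\<close>

lemma vandermonde_rows:
  fixes c :: "nat \<Rightarrow> 'a::idom"
  assumes "inj_on x P" "card P \<ge> N" "\<And>i. i \<in> P \<Longrightarrow> (\<Sum>k<N. c k * x i ^ k) = 0" "k < N"
  shows "c k = 0"
proof -
  have "(\<Sum>k<N. monom (c k) k) = 0"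
    using assms by (intro poly_zero_on_card[of _ N x P])
      (auto simp: degree_power_sum_less poly_power_sum)
  then have "coeff (\<Sum>k<N. monom (c k) k) k = 0" by simp
  then show ?thesis using assms(4) by (simp add: coeff_sum sum.delta)
qed

text \<open>Weighting the equations by the coefficients of a polynomial \<open>f\<close> of degree
  below \<open>N\<close> gives a relation among the values of \<open>f\<close>; choosing
  \<open>f\<close> to vanish at all points but \<open>x i\<close> isolates
  \<open>d i\<close>.\<close>

lemma vandermonde_cols:
  fixes d :: "'i \<Rightarrow> 'a::idom"
  assumes fin: "finite P" and inj: "inj_on x P" and N: "card P \<le> N"
    and z: "\<And>k. k < N \<Longrightarrow> (\<Sum>i\<in>P. d i * x i ^ k) = 0" and i: "i \<in> P"
  shows "d i = 0"
proof -
  define f where "f = (\<Prod>j\<in>P - {i}. [:- x j, 1:])"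
  have "degree f \<le> (\<Sum>j\<in>P - {i}. degree [:- x j, 1:])"
    unfolding f_def using degree_prod_sum_le[of "P - {i}" "\<lambda>j. [:- x j, 1:]"] fin by (simp add: o_def)
  also have "\<dots> = card P - 1" using fin i by simp
  also have "\<dots> < N" using N i fin by (metis card_gt_0_iff diff_less empty_iff less_le_trans zero_less_one)
  finally have deg: "degree f < N" .
  have "(\<Sum>j\<in>P. d j * poly f (x j)) = (\<Sum>j\<in>P. \<Sum>k\<le>degree f. coeff f k * (d j * x j ^ k))"
    by (intro sum.cong) (simp_all add: poly_altdef sum_distrib_left mult_ac)
  also have "\<dots> = (\<Sum>k\<le>degree f. coeff f k * (\<Sum>j\<in>P. d j * x j ^ k))"
    by (subst sum.swap) (simp add: sum_distrib_left)
  also have "\<dots> = 0" using z deg by (intro sum.neutral) auto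
  finally have "(\<Sum>j\<in>P. d j * poly f (x j)) = 0" .
  moreover have "d j * poly f (x j) = 0" if "j \<in> P - {i}" for j
    using that fin by (auto simp: f_def poly_prod)
  ultimately have "d i * poly f (x i) = 0"
    using i fin by (simp add: sum.remove[of P i] sum.neutral)
  moreover have "poly f (x i) \<noteq> 0"
    using inj i fin by (auto simp: f_def poly_prod inj_on_def)
  ultimately show ?thesis by simp
qed

text \<open>\<open>l p z\<close> is the value at \<open>z\<close> of the Lagrange basis polynomial
  of \<open>p\<close>. It expresses a Vandermonde column at \<open>z\<close> through the columns at
  \<open>P\<close>. Staying inside the subfield is what later lets these coefficients commute with
  the twists.\<close>

lemma (in field_subset) lagrange_interpolation:
  assumes fin: "finite P" and inj: "inj_on x P" and x: "x ` P \<subseteq> K"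
  obtains l where "\<And>p z. p \<in> P \<Longrightarrow> z \<in> K \<Longrightarrow> l p z \<in> K"
    and "\<And>k z. k < card P \<Longrightarrow> (\<Sum>p\<in>P. x p ^ k * l p z) = z ^ k"
proof -
  define L where "L p = (\<Prod>s\<in>P - {p}. smult (inverse (x p - x s)) [:- x s, 1:])" for p
  have degL: "degree (L p) \<le> card P - 1" if "p \<in> P" for p
  proof -
    have "degree (L p) \<le> (\<Sum>s\<in>P - {p}. degree (smult (inverse (x p - x s)) [:- x s, 1:]))"
      unfolding L_def using fin degree_prod_sum_le[of "P - {p}" "\<lambda>s. smult (inverse (x p - x s)) [:- x s, 1:]"]
      by (simp add: o_def)
    also have "\<dots> \<le> (\<Sum>s\<in>P - {p}. 1)" by (intro sum_mono) auto
    also have "\<dots> = card P - 1" using fin that by simp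
    finally show ?thesis .
  qed
  have polyL: "poly (L p) (x s) = (if s = p then 1 else 0)" if "p \<in> P" "s \<in> P" for p s
  proof (cases "s = p")
    case True
    have "poly (L p) (x p) = (\<Prod>s\<in>P - {p}. inverse (x p - x s) * (x p - x s))"
      by (simp add: L_def poly_prod algebra_simps)
    also have "\<dots> = 1" using inj that by (intro prod.neutral ballI Fields.field_class.field_inverse) (auto simp: inj_on_def)
    finally show ?thesis using True by simp
  next
    case False
    then show ?thesis using that fin by (auto simp: L_def poly_prod)
  qed
  show ?thesis
  proof (rule that[of "\<lambda>p z. poly (L p) z"])
    fix p z assume "p \<in> P" "z \<in> K"
    then show "poly (L p) z \<in> K"
      using x by (auto simp: L_def poly_prod intro!: closed)
  next
    fix k z assume k: "k < card P"
    \<comment> \<open>The interpolant of \<open>X^k\<close> minus \<open>X^k\<close> itself: its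
      degree is below \<open>card P\<close>, yet it vanishes on all of \<open>P\<close>.\<close>
    define D where "D = (\<Sum>p\<in>P. smult (x p ^ k) (L p)) - monom 1 k"
    have "D = 0"
    proof (rule poly_zero_on_card[OF _ inj order_refl])
      have "degree D \<le> card P - 1"
        unfolding D_def using k degL
        by (intro degree_diff_le degree_sum_le fin)
           (auto intro!: order_trans[OF degree_smult_le] order_trans[OF degree_monom_le])
      then show "degree D < card P" using k by linarith
      fix s assume s: "s \<in> P"
      have "poly D (x s) = (\<Sum>p\<in>P. x p ^ k * (if s = p then 1 else 0)) - x s ^ k"
        using s by (simp add: D_def poly_sum poly_monom polyL)
      also have "\<dots> = 0" using s fin by (simp add: sum.delta if_distrib[of "\<lambda>x. _ * x"] cong: if_cong)
      finally show "poly D (x s) = 0" .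
    qed
    then have "poly D z = 0" by simp
    then show "(\<Sum>p\<in>P. x p ^ k * poly (L p) z) = z ^ k"
      by (simp add: D_def poly_sum poly_monom)
  qed
qed

section \<open>Skew Moore matrices\<close>

text \<open>\<open>F\<close> is the fixed field of the additive map \<open>u \<mapsto> u^q\<close>,
  which is therefore \<open>F\<close>-linear.\<close>

locale frobenius =
  fixes q :: nat and F :: "'a::Fields.field set"
  assumes q_gt_1: "q > 1"
    and frob_add: "\<And>x y :: 'a. (x + y) ^ q = x ^ q + y ^ q"
    and F_eq: "F = fixed_points q"
begin

sublocale F: field_subset F
  unfolding F_eq using q_gt_1 frob_add by (intro field_subset_fixed_points) auto

lemma F_iff: "x \<in> F \<longleftrightarrow> x ^ q = x"
  by (simp add: F_eq fixed_points_def)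

text \<open>For \<open>\<gamma> = \<gamma> b\<close> this is the map \<open>\<phi>\<^sub>b\<close>
  of the introduction. Its iterate of order \<open>s\<close> sends \<open>u\<close> to
  \<open>u\<close> to the power \<open>q^s\<close>, times \<open>\<gamma>\<close> to the power
  \<open>1 + q + ... + q^(s-1)\<close>.\<close>

definition twist :: "'a \<Rightarrow> 'a \<Rightarrow> 'a" where
  "twist \<gamma> u = \<gamma> * u ^ q"

lemma twist_pow_scale: "(twist \<gamma> ^^ s) (b * u) = b ^ (q ^ s) * (twist \<gamma> ^^ s) u"
  by (induction s) (simp_all add: twist_def power_mult_distrib mult_ac flip: power_mult)

lemma twist_pow_add: "(twist \<gamma> ^^ s) (u + v) = (twist \<gamma> ^^ s) u + (twist \<gamma> ^^ s) v"
  by (induction s) (simp_all add: twist_def frob_add algebra_simps)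

lemma twist_pow_diff: "(twist \<gamma> ^^ s) (u - v) = (twist \<gamma> ^^ s) u - (twist \<gamma> ^^ s) v"
  using twist_pow_add[of s \<gamma> "u - v" v] by simp

lemma twist_pow_zero: "(twist \<gamma> ^^ s) 0 = 0"
  using twist_pow_diff[of s \<gamma> 0 0] by simp

lemma twist_pow_F_scale: "c \<in> F \<Longrightarrow> (twist \<gamma> ^^ s) (c * u) = c * (twist \<gamma> ^^ s) u"
proof -
  assume c: "c \<in> F"
  have "c ^ (q ^ s) = c" using c by (induction s) (simp_all add: F_iff power_mult)
  then show ?thesis by (simp add: twist_pow_scale)
qed

lemma twist_pow_sum:
  "(\<And>i. i \<in> I \<Longrightarrow> c i \<in> F) \<Longrightarrow>
    (twist \<gamma> ^^ s) (\<Sum>i\<in>I. c i * u i) = (\<Sum>i\<in>I. c i * (twist \<gamma> ^^ s) (u i))"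
  by (induction I rule: infinite_finite_induct)
     (simp_all add: twist_pow_zero twist_pow_add twist_pow_F_scale)

text \<open>Subtracting \<open>b^(q^s)\<close> times equation \<open>s\<close> from equation \<open>s + 1\<close> replaces every \<open>u\<close> by
  \<open>twist \<gamma> u - b u\<close>. The choice of \<open>b\<close> kills one column, and by inequivalence of the \<open>\<gamma>\<close>'s the
  kernel of the \<open>F\<close>-linear map \<open>u \<mapsto> twist \<gamma> u - b u\<close> contains nothing but the \<open>F\<close>-multiples of
  that column.\<close>

lemma skew_moore_independent:
  fixes \<gamma> :: "'i \<Rightarrow> 'a" and grp :: "'j \<Rightarrow> 'i"
  assumes K: "field_subset K" and FK: "F \<subseteq> K"
    and \<gamma>: "\<And>j. j \<in> T \<Longrightarrow> \<gamma> (grp j) \<in> K - {0}"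
    and inequiv: "\<And>j j' z. j \<in> T \<Longrightarrow> j' \<in> T \<Longrightarrow> z \<in> K \<Longrightarrow> z \<noteq> 0 \<Longrightarrow>
      \<gamma> (grp j) * z ^ (q - 1) = \<gamma> (grp j') \<Longrightarrow> grp j = grp j'"
    and "finite T" "card T \<le> m"
    and "\<And>j. j \<in> T \<Longrightarrow> u j \<in> K"
    and "\<And>c. (\<forall>j\<in>T. c j \<in> F) \<Longrightarrow> \<forall>i. (\<Sum>j\<in>{j\<in>T. grp j = i}. c j * u j) = 0 \<Longrightarrow> \<forall>j\<in>T. c j = 0"
    and "\<And>s. s < m \<Longrightarrow> (\<Sum>j\<in>T. d j * (twist (\<gamma> (grp j)) ^^ s) (u j)) = 0"
  shows "\<forall>j\<in>T. d j = 0"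
  using assms(3-)
proof (induction m arbitrary: T u)
  case 0
  then show ?case by simp
next
  case (Suc m)
  interpret K: field_subset K by fact
  show ?case
  proof (cases "T = {}")
    case False
    then obtain t where t: "t \<in> T" by blast
    let ?i = "grp t"
    note fin = \<open>finite T\<close>
    \<comment> \<open>If \<open>u t\<close> were zero, the indicator function of \<open>t\<close>
      would be a nontrivial relation over \<open>F\<close>.\<close>
    have ut: "u t \<noteq> 0"
    proof
      assume ut: "u t = 0"
      have "\<forall>j\<in>T. (if j = t then 1 else 0 :: 'a) = 0"
        by (rule Suc.prems(6)) (auto simp: ut F.closed intro!: sum.neutral)
      then show False using t by auto
    qed
    \<comment> \<open>\<open>b\<close> is the quotient of \<open>twist (\<gamma> ?i) (u t)\<close>
      by \<open>u t\<close>.\<close>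
    define b where "b = \<gamma> ?i * u t ^ (q - 1)"
    define u' where "u' j = twist (\<gamma> (grp j)) (u j) - b * u j" for j
    have pow_q: "x ^ q = x ^ (q - 1) * x" for x :: 'a
      using q_gt_1 by (metis One_nat_def Suc_pred gr_implies_not0 neq0_conv power_Suc2)
    have u't: "u' t = 0" by (simp add: u'_def b_def twist_def pow_q)
    let ?T = "T - {t}"
    have IH: "\<forall>j\<in>?T. d j = 0"
    proof (rule Suc.IH)
      show "card ?T \<le> m" using Suc.prems(4) t fin by simp
      show "u' j \<in> K" if "j \<in> ?T" for j
        using that t Suc.prems(1,5) by (auto simp: u'_def b_def twist_def intro!: K.closed)
      fix s assume s: "s < m"
      have "(\<Sum>j\<in>?T. d j * (twist (\<gamma> (grp j)) ^^ s) (u' j)) =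
            (\<Sum>j\<in>T. d j * (twist (\<gamma> (grp j)) ^^ s) (u' j))"
        using t fin by (simp add: sum.remove[of T t] u't twist_pow_zero)
      also have "\<dots> = (\<Sum>j\<in>T. d j * (twist (\<gamma> (grp j)) ^^ Suc s) (u j)
          - b ^ (q ^ s) * (d j * (twist (\<gamma> (grp j)) ^^ s) (u j)))"
        by (intro sum.cong)
           (simp_all add: u'_def twist_pow_diff twist_pow_scale funpow_Suc_right algebra_simps
             del: funpow.simps)
      also have "\<dots> = 0"
        unfolding sum_subtractf sum_distrib_left[symmetric]
        using Suc.prems(7)[of s] Suc.prems(7)[of "Suc s"] s by simp
      finally show "(\<Sum>j\<in>?T. d j * (twist (\<gamma> (grp j)) ^^ s) (u' j)) = 0" .
    next
      fix c assume c: "\<forall>j\<in>?T. c j \<in> F" and 0: "\<forall>i. (\<Sum>j\<in>{j \<in> ?T. grp j = i}. c j * u' j) = 0"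
      \<comment> \<open>By \<open>F\<close>-linearity, the relation among the \<open>u'\<close> in
        group \<open>i\<close> says that \<open>twist (\<gamma> i)\<close> multiplies
        \<open>w i\<close> by \<open>b\<close>.\<close>
      define w where "w i = (\<Sum>j\<in>{j \<in> ?T. grp j = i}. c j * u j)" for i
      have w_eq: "\<gamma> i * w i ^ q = b * w i" for i
      proof -
        have "(twist (\<gamma> i) ^^ 1) (w i) - b * w i = (\<Sum>j\<in>{j \<in> ?T. grp j = i}. c j * u' j)"
          unfolding w_def
          by (subst twist_pow_sum) (use c in \<open>auto simp: u'_def sum_distrib_left right_diff_distrib
            mult_ac sum_subtractf[symmetric] intro!: sum.cong\<close>)
        then show ?thesis using 0 by (simp add: twist_def)
      qed
      have wK: "w i \<in> K" for i
        unfolding w_def using c FK Suc.prems(5) by (intro K.sum_closed K.mult_closed) auto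
      have w_other: "w i = 0" if i: "i \<noteq> ?i" for i
      proof (rule ccontr)
        assume nz: "w i \<noteq> 0"
        \<comment> \<open>Inequivalence concerns only groups that meet \<open>T\<close>; a nonzero
          sum supplies a member of group \<open>i\<close>.\<close>
        then obtain j where j: "j \<in> ?T" "grp j = i"
          unfolding w_def by (metis (mono_tags, lifting) mem_Collect_eq sum.neutral)
        have "\<gamma> i * w i ^ (q - 1) = b" using w_eq[of i] nz by (simp add: pow_q)
        then have "\<gamma> i * (w i / u t) ^ (q - 1) = \<gamma> ?i"
          using ut by (simp add: b_def power_divide)
        then show False
          using Suc.prems(2)[of j t "w i / u t"] i j t nz ut wK Suc.prems(5) by (auto intro: K.closed)
      qed
      \<comment> \<open>In the group of \<open>t\<close>, both \<open>w ?i\<close> and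
        \<open>u t\<close> are multiplied by \<open>b\<close>, so their quotient is fixed by the
        \<open>q\<close>-th power and lies in \<open>F\<close>. Giving \<open>t\<close> the
        coefficient \<open>- f\<close> turns \<open>c\<close> into a relation among the original
        \<open>u\<close>.\<close>
      define f where "f = w ?i / u t"
      have "w ?i ^ q = u t ^ (q - 1) * w ?i"
        using w_eq[of ?i] Suc.prems(1)[OF t] by (simp add: b_def)
      then have fF: "f \<in> F"
        using ut by (simp add: F_iff f_def power_divide pow_q[of "u t"])
      have "\<forall>j\<in>T. (c(t := - f)) j = 0"
      proof (rule Suc.prems(6))
        show "\<forall>j\<in>T. (c(t := - f)) j \<in> F" using c fF by (auto intro: F.closed)
        show "\<forall>i. (\<Sum>j\<in>{j \<in> T. grp j = i}. (c(t := - f)) j * u j) = 0"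
        proof
          fix i
          have eq: "(\<Sum>j\<in>{j \<in> ?T. grp j = i}. (c(t := - f)) j * u j) = w i"
            unfolding w_def by (intro sum.cong) auto
          show "(\<Sum>j\<in>{j \<in> T. grp j = i}. (c(t := - f)) j * u j) = 0"
          proof (cases "i = ?i")
            case True
            have "{j \<in> T. grp j = i} = insert t {j \<in> ?T. grp j = i}" using t True by auto
            then show ?thesis using eq fin ut True by (simp add: f_def)
          next
            case False
            then have "{j \<in> T. grp j = i} = {j \<in> ?T. grp j = i}" by auto
            then show ?thesis using eq w_other[OF False] by simp
          qed
        qed
      qed
      then show "\<forall>j\<in>?T. c j = 0" by (auto split: if_splits)
    qed (use Suc.prems in auto)
    have "(\<Sum>j\<in>T. d j * u j) = 0" using Suc.prems(7)[of 0] by simp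
    then have "d t * u t = 0" using IH t fin by (simp add: sum.remove[of T t])
    then show ?thesis using IH ut by auto
  qed simp
qed

end

section \<open>The code\<close>

text \<open>\<open>\<gamma>_inequiv\<close> puts the \<open>\<gamma> b\<close> into different
  classes modulo the \<open>(q - 1)\<close>-th powers of nonzero elements of \<open>K\<close>. When
  \<open>K\<close> has \<open>q^h\<close> elements, this is the same as distinct norms in
  \<open>F\<close>.\<close>

locale linearized_rs_code = frobenius q F
  for q :: nat and F :: "'a::Fields.field set" +
  fixes K :: "'a set" and a r g h :: nat and x w \<gamma> :: "nat \<Rightarrow> 'a"
  assumes K: "field_subset K" and K_finite: "finite K" and F_le_K: "F \<subseteq> K"
    and r_pos: "0 < r" and dims: "g * a + h < g * r"
    and x_F: "i < r \<Longrightarrow> x i \<in> F" and x_inj: "inj_on x {..<r}"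
    and w_K: "k < h \<Longrightarrow> w k \<in> K"
    and w_indep: "(\<forall>k<h. c k \<in> F) \<Longrightarrow> (\<Sum>k<h. c k * w k) = 0 \<Longrightarrow> \<forall>k<h. c k = 0"
    and \<gamma>_K: "b < g \<Longrightarrow> \<gamma> b \<in> K - {0}"
    and \<gamma>_inequiv: "b < g \<Longrightarrow> b' < g \<Longrightarrow> z \<in> K \<Longrightarrow> z \<noteq> 0 \<Longrightarrow> \<gamma> b * z ^ (q - 1) = \<gamma> b' \<Longrightarrow> b = b'"
begin

sublocale K: field_subset K by (rule K)

text \<open>The exponents continue where those of the local rows \<open>0, ..., a - 1\<close> stop,
  so that together they form one Vandermonde system with \<open>a + h\<close> rows.\<close>

definition \<beta> :: "nat \<Rightarrow> 'a" where
  "\<beta> c = (\<Sum>k<h. x c ^ (a + k) * w k)"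

definition H :: "nat \<Rightarrow> nat \<Rightarrow> 'a" where
  "H i j = (if i < g * a then if j div r = i div a then x (j mod r) ^ (i mod a) else 0
            else (twist (\<gamma> (j div r)) ^^ (i - g * a)) (\<beta> (j mod r)))"

lemma a_less_r: "a < r"
proof (rule ccontr)
  assume "\<not> a < r"
  then have "g * r \<le> g * a" by simp
  then show False using dims by linarith
qed

lemma x_K: "c < r \<Longrightarrow> x c \<in> K"
  using x_F F_le_K by blast

lemma \<beta>_K: "c < r \<Longrightarrow> \<beta> c \<in> K"
  unfolding \<beta>_def by (intro K.closed x_K w_K) auto

lemma twist_pow_K: "b < g \<Longrightarrow> u \<in> K \<Longrightarrow> (twist (\<gamma> b) ^^ s) u \<in> K"
  using \<gamma>_K by (induction s) (auto simp: twist_def intro!: K.closed)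

lemma H_K: "j < g * r \<Longrightarrow> H i j \<in> K"
  unfolding H_def using r_pos less_mult_imp_div_less[of j g r]
  by (auto intro!: K.closed x_K \<beta>_K twist_pow_K)

lemma block_index: "b < g \<Longrightarrow> k < a \<Longrightarrow> b * a + k < g * a"
  using mult_le_mono1[of "Suc b" g a] by simp

lemma H_local_sum:
  assumes "finite S" "b < g" "k < a"
  shows "(\<Sum>j\<in>S. c j * H (b * a + k) j) = (\<Sum>j\<in>{j\<in>S. j div r = b}. c j * x (j mod r) ^ k)"
proof -
  have "(\<Sum>j\<in>S. c j * H (b * a + k) j) = (\<Sum>j\<in>S. if j div r = b then c j * x (j mod r) ^ k else 0)"
    using assms by (intro sum.cong) (auto simp: H_def block_index)
  then show ?thesis using assms by (simp add: sum.inter_filter)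
qed

text \<open>The local equations determine \<open>c\<close> on \<open>a\<close> columns
  \<open>Q b\<close> of each group from its values on the other columns. Substitution into the
  global equations leaves a skew Moore system on the \<open>h\<close> columns of \<open>T\<close>,
  with entries built from \<open>u\<close>. Its solution is zero, and then elimination gives zero on
  each \<open>Q b\<close>.\<close>

lemma H_cols_independent:
  assumes S: "S \<subseteq> {..<g * r}" "card S = g * a + h"
    and S_a: "\<And>b. b < g \<Longrightarrow> a \<le> card {j\<in>S. j div r = b}"
    and zero: "\<And>i. i < g * a + h \<Longrightarrow> (\<Sum>j\<in>S. c j * H i j) = 0"
  shows "\<forall>j\<in>S. c j = 0"
proof -
  define Y where "Y j = x (j mod r)" for j
  define B where "B j = \<beta> (j mod r)" for j
  define \<tau> where "\<tau> b s = (twist (\<gamma> b) ^^ s)" for b s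
  have fin: "finite S" using S finite_subset by blast
  have grp: "j div r < g" if "j \<in> S" for j
    using that S by (auto intro: less_mult_imp_div_less)
  have Y_F: "Y j \<in> F" for j unfolding Y_def using x_F r_pos by simp
  have Y_inj: "inj_on Y {j\<in>S. j div r = b}" for b
  proof (rule inj_onI)
    fix j j' assume j: "j \<in> {j\<in>S. j div r = b}" "j' \<in> {j\<in>S. j div r = b}" and "Y j = Y j'"
    then have "j mod r = j' mod r" using x_inj r_pos by (auto simp: Y_def inj_on_def)
    then show "j = j'" using j by (metis (mono_tags, lifting) div_mult_mod_eq mem_Collect_eq)
  qed
  \<comment> \<open>The subset of a group and its interpolation coefficients form one predicate, so
    that both can be chosen for all groups at once.\<close>
  define R where "R b Q l \<longleftrightarrow> Q \<subseteq> {j\<in>S. j div r = b} \<and> card Q = a \<and> (\<forall>p\<in>Q. \<forall>z\<in>F. l p z \<in> F) \<and>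
      (\<forall>k z. k < a \<longrightarrow> (\<Sum>p\<in>Q. Y p ^ k * l p z) = z ^ k)" for b Q l
  have "\<exists>Q l. R b Q l" if b: "b < g" for b
  proof -
    obtain Q where Q: "Q \<subseteq> {j\<in>S. j div r = b}" "card Q = a"
      using obtain_subset_with_card_n[OF S_a[OF b]] by metis
    have "finite Q" using Q fin by (auto intro: finite_subset)
    moreover have "Y ` Q \<subseteq> F" using Y_F by blast
    ultimately obtain l where "\<And>p z. p \<in> Q \<Longrightarrow> z \<in> F \<Longrightarrow> l p z \<in> F"
        "\<And>k z. k < card Q \<Longrightarrow> (\<Sum>p\<in>Q. Y p ^ k * l p z) = z ^ k"
      using F.lagrange_interpolation[OF _ inj_on_subset[OF Y_inj Q(1)]] by blast
    then show ?thesis using Q unfolding R_def by blast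
  qed
  then obtain Q l where R: "\<And>b. b < g \<Longrightarrow> R b (Q b) (l b)" by metis
  have Q: "Q b \<subseteq> {j\<in>S. j div r = b}" "card (Q b) = a" if "b < g" for b
    using R[OF that] by (simp_all add: R_def)
  have l_F: "l b p z \<in> F" if "b < g" "p \<in> Q b" "z \<in> F" for b p z
    using R[OF that(1)] that(2,3) by (simp add: R_def)
  have l_eq: "(\<Sum>p\<in>Q b. Y p ^ k * l b p z) = z ^ k" if "b < g" "k < a" for b k z
    using R[OF that(1)] that(2) by (simp add: R_def)
  have Q_fin: "finite (Q b)" if "b < g" for b using Q(1)[OF that] fin by (auto intro: finite_subset)
  define P where "P = (\<Union>b<g. Q b)"
  define T where "T = S - P"
  define Tb where "Tb b = {j\<in>T. j div r = b}" for b
  have Tb_fin: "finite (Tb b)" for b unfolding Tb_def T_def using fin by simp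
  have PS: "P \<subseteq> S" unfolding P_def using Q(1) by auto
  have P_iff: "p \<in> P \<and> p div r = b \<longleftrightarrow> p \<in> Q b" if "b < g" for p b
    using Q(1) that unfolding P_def by auto
  have Q_disj: "Q b \<inter> Tb b' = {}" if "b < g" for b b'
    using that unfolding T_def Tb_def P_def by auto
  have split_b: "{j\<in>S. j div r = b} = Q b \<union> Tb b" if "b < g" for b
    using P_iff[OF that] PS Q(1)[OF that] unfolding Tb_def T_def by auto
  have "card P = (\<Sum>b<g. card (Q b))"
    unfolding P_def
  proof (rule card_UN_disjoint)
    show "\<forall>b\<in>{..<g}. \<forall>b'\<in>{..<g}. b \<noteq> b' \<longrightarrow> Q b \<inter> Q b' = {}" using Q(1) by blast
  qed (simp_all add: Q_fin)
  also have "\<dots> = g * a" by (simp add: Q(2))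
  finally have "card P = g * a" .
  then have card_T: "card T = h"
    unfolding T_def using S(2) PS fin by (simp add: card_Diff_subset finite_subset)
  \<comment> \<open>The columns of a group outside \<open>Q b\<close> lie in \<open>T\<close>, which
    has \<open>h\<close> elements. So the exponents below \<open>a + h\<close> will be enough for a
    Vandermonde argument within one group.\<close>
  have card_Sb: "card {j\<in>S. j div r = b} \<le> a + h" if b: "b < g" for b
  proof -
    have "card {j\<in>S. j div r = b} \<le> card (Q b) + card (Tb b)"
      unfolding split_b[OF b] by (rule card_Un_le)
    also have "\<dots> \<le> a + card T"
      using Q(2)[OF b] fin by (auto simp: Tb_def T_def intro!: card_mono)
    finally show ?thesis using card_T by simp
  qed
  \<comment> \<open>Interpolating every column of \<open>Tb b\<close> from \<open>Q b\<close> turns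
    the local relation into one among the \<open>a\<close> columns of \<open>Q b\<close>, which are
    independent.\<close>
  have elim: "d p = - (\<Sum>j\<in>Tb b. d j * l b p (Y j))"
    if b: "b < g" and d: "\<And>k. k < a \<Longrightarrow> (\<Sum>j\<in>{j\<in>S. j div r = b}. d j * Y j ^ k) = 0" and p: "p \<in> Q b"
    for d :: "nat \<Rightarrow> 'a" and b p
  proof -
    have "d p + (\<Sum>j\<in>Tb b. d j * l b p (Y j)) = 0"
    proof (rule vandermonde_cols[OF Q_fin[OF b] _ _ _ p])
      show "inj_on Y (Q b)" by (rule inj_on_subset[OF Y_inj Q(1)[OF b]])
      show "card (Q b) \<le> a" using Q(2)[OF b] by simp
      fix k assume k: "k < a"
      have "(\<Sum>p\<in>Q b. (d p + (\<Sum>j\<in>Tb b. d j * l b p (Y j))) * Y p ^ k) =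
          (\<Sum>p\<in>Q b. d p * Y p ^ k) + (\<Sum>p\<in>Q b. \<Sum>j\<in>Tb b. d j * (Y p ^ k * l b p (Y j)))"
        by (simp add: algebra_simps sum.distrib sum_distrib_left)
      also have "(\<Sum>p\<in>Q b. \<Sum>j\<in>Tb b. d j * (Y p ^ k * l b p (Y j))) = (\<Sum>j\<in>Tb b. d j * Y j ^ k)"
        by (subst sum.swap) (simp add: sum_distrib_left[symmetric] l_eq[OF b k])
      also have "(\<Sum>p\<in>Q b. d p * Y p ^ k) + \<dots> = (\<Sum>j\<in>{j\<in>S. j div r = b}. d j * Y j ^ k)"
        unfolding split_b[OF b] using Q_fin[OF b] Tb_fin Q_disj[OF b] by (simp add: sum.union_disjoint)
      finally show "(\<Sum>p\<in>Q b. (d p + (\<Sum>j\<in>Tb b. d j * l b p (Y j))) * Y p ^ k) = 0"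
        using d[OF k] by simp
    qed
    then show ?thesis by (simp add: eq_neg_iff_add_eq_0)
  qed
  have c_local: "(\<Sum>j\<in>{j\<in>S. j div r = b}. c j * Y j ^ k) = 0" if "b < g" "k < a" for b k
    using zero[of "b * a + k"] H_local_sum[OF fin that, of c] block_index[OF that]
    by (simp add: Y_def)
  have c_elim: "c p = - (\<Sum>j\<in>Tb b. c j * l b p (Y j))" if "b < g" "p \<in> Q b" for b p
    by (rule elim[OF that(1) _ that(2)]) (rule c_local[OF that(1)])
  \<comment> \<open>The element that remains at column \<open>j\<close> once its interpolation from
    \<open>Q (j div r)\<close> is subtracted.\<close>
  define u where "u j = B j - (\<Sum>p\<in>Q (j div r). l (j div r) p (Y j) * B p)" for j
  have B_K: "B j \<in> K" for j unfolding B_def using \<beta>_K r_pos by simp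
  have TS: "T \<subseteq> S" unfolding T_def by blast
  have l_FT: "l (j div r) p (Y j) \<in> F" if "j \<in> T" "p \<in> Q (j div r)" for j p
    using that TS grp Y_F l_F by blast
  have eqs_T: "(\<Sum>j\<in>T. c j * \<tau> (j div r) s (u j)) = 0" if s: "s < h" for s
  proof -
    have by_grp: "(\<Sum>j\<in>A. f j) = (\<Sum>b<g. \<Sum>j\<in>{j\<in>A. j div r = b}. f j)" if "A \<subseteq> S" for A and f :: "nat \<Rightarrow> 'a"
      using that grp fin by (intro sum.group[symmetric]) (auto intro: finite_subset)
    have "0 = (\<Sum>j\<in>S. c j * \<tau> (j div r) s (B j))"
      using zero[of "g * a + s"] s by (simp add: H_def \<tau>_def B_def)
    also have "\<dots> = (\<Sum>b<g. \<Sum>j\<in>{j\<in>S. j div r = b}. c j * \<tau> (j div r) s (B j))"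
      by (rule by_grp) simp
    also have "\<dots> = (\<Sum>b<g. \<Sum>j\<in>Tb b. c j * \<tau> (j div r) s (u j))"
    proof (rule sum.cong[OF refl])
      fix b assume "b \<in> {..<g}"
      then have b: "b < g" by simp
      have "(\<Sum>p\<in>Q b. c p * \<tau> (p div r) s (B p)) = (\<Sum>p\<in>Q b. \<Sum>j\<in>Tb b. - (c j * (l b p (Y j) * \<tau> b s (B p))))"
      proof (rule sum.cong[OF refl])
        fix p assume p: "p \<in> Q b"
        then have "p div r = b" using Q(1)[OF b] by auto
        then show "c p * \<tau> (p div r) s (B p) = (\<Sum>j\<in>Tb b. - (c j * (l b p (Y j) * \<tau> b s (B p))))"
          by (subst c_elim[OF b p]) (auto simp: sum_distrib_left sum_negf mult_ac)
      qed
      also have "\<dots> = (\<Sum>j\<in>Tb b. - (c j * (\<Sum>p\<in>Q b. l b p (Y j) * \<tau> b s (B p))))"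
        by (subst sum.swap) (simp add: sum_distrib_left sum_negf)
      finally have Q_sum: "(\<Sum>p\<in>Q b. c p * \<tau> (p div r) s (B p)) =
        (\<Sum>j\<in>Tb b. - (c j * (\<Sum>p\<in>Q b. l b p (Y j) * \<tau> b s (B p))))" .
      have "(\<Sum>j\<in>{j\<in>S. j div r = b}. c j * \<tau> (j div r) s (B j)) =
          (\<Sum>p\<in>Q b. c p * \<tau> (p div r) s (B p)) + (\<Sum>j\<in>Tb b. c j * \<tau> (j div r) s (B j))"
        unfolding split_b[OF b] using Q_fin[OF b] Tb_fin Q_disj[OF b] by (simp add: sum.union_disjoint)
      also have "\<dots> = (\<Sum>j\<in>Tb b. c j * (\<tau> b s (B j) - (\<Sum>p\<in>Q b. l b p (Y j) * \<tau> b s (B p))))"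
        unfolding Q_sum sum.distrib[symmetric]
        by (intro sum.cong) (auto simp: Tb_def right_diff_distrib)
      also have "\<dots> = (\<Sum>j\<in>Tb b. c j * \<tau> (j div r) s (u j))"
      proof (rule sum.cong[OF refl])
        fix j assume "j \<in> Tb b"
        then have j: "j \<in> T" "j div r = b" by (auto simp: Tb_def)
        \<comment> \<open>The interpolation coefficients lie in \<open>F\<close>, so the iterated
          twist passes through them.\<close>
        have "\<tau> b s (\<Sum>p\<in>Q b. l b p (Y j) * B p) = (\<Sum>p\<in>Q b. l b p (Y j) * \<tau> b s (B p))"
          unfolding \<tau>_def by (rule twist_pow_sum) (use l_FT[OF j(1)] j(2) in auto)
        then show "c j * (\<tau> b s (B j) - (\<Sum>p\<in>Q b. l b p (Y j) * \<tau> b s (B p))) = c j * \<tau> (j div r) s (u j)"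
          by (simp add: u_def j(2)) (simp add: \<tau>_def twist_pow_diff)
      qed
      finally show "(\<Sum>j\<in>{j\<in>S. j div r = b}. c j * \<tau> (j div r) s (B j)) =
        (\<Sum>j\<in>Tb b. c j * \<tau> (j div r) s (u j))" .
    qed
    also have "\<dots> = (\<Sum>j\<in>T. c j * \<tau> (j div r) s (u j))"
      unfolding Tb_def by (rule by_grp[symmetric]) (rule TS)
    finally show ?thesis ..
  qed
  have c_T: "\<forall>j\<in>T. c j = 0"
  proof (rule skew_moore_independent[OF K F_le_K, of T \<gamma> "\<lambda>j. j div r" h u])
    show "\<gamma> (j div r) \<in> K - {0}" if "j \<in> T" for j
      using that TS grp \<gamma>_K by blast
    show "j div r = j' div r" if "j \<in> T" "j' \<in> T" "z \<in> K" "z \<noteq> 0"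
      "\<gamma> (j div r) * z ^ (q - 1) = \<gamma> (j' div r)" for j j' z
      using that TS grp \<gamma>_inequiv by blast
    show "finite T" "card T \<le> h" using TS fin card_T by (auto intro: finite_subset)
    show "u j \<in> K" if "j \<in> T" for j
      unfolding u_def using l_FT[OF that] F_le_K by (intro K.closed B_K) auto
    show "(\<Sum>j\<in>T. c j * (twist (\<gamma> (j div r)) ^^ s) (u j)) = 0" if "s < h" for s
      using eqs_T[OF that] by (simp add: \<tau>_def)
  next
    fix e assume e: "\<forall>j\<in>T. e j \<in> F" and 0: "\<forall>i. (\<Sum>j\<in>{j \<in> T. j div r = i}. e j * u j) = 0"
    \<comment> \<open>Extends \<open>e\<close> from \<open>T\<close> to the eliminated columns by
      the same elimination formula, so that the local equations hold for \<open>d\<close>.\<close>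
    define d where "d j = (if j \<in> T then e j else - (\<Sum>i\<in>Tb (j div r). e i * l (j div r) j (Y i)))" for j
    show "\<forall>j\<in>T. e j = 0"
    proof
      fix j0 assume j0: "j0 \<in> T"
      define b where "b = j0 div r"
      have b: "b < g" unfolding b_def using j0 TS grp by blast
      have d_F: "d j \<in> F" if "j \<in> Q b \<union> Tb b" for j
      proof (cases "j \<in> T")
        case True
        then show ?thesis using e by (simp add: d_def)
      next
        case False
        then have j: "j \<in> Q b" "j div r = b" using that Q(1)[OF b] by (auto simp: Tb_def)
        show ?thesis unfolding d_def using False j e b
          by (auto simp: Tb_def intro!: F.closed l_F Y_F)
      qed
      \<comment> \<open>Applied to powers of \<open>Y\<close> below \<open>a\<close>, where
        interpolation is exact and the bracket vanishes, and to \<open>B\<close>, where the bracket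
        is \<open>u j\<close>.\<close>
      have d_sum: "(\<Sum>j\<in>{j\<in>S. j div r = b}. d j * f j) =
          (\<Sum>j\<in>Tb b. e j * (f j - (\<Sum>p\<in>Q b. l b p (Y j) * f p)))" for f
      proof -
        have "(\<Sum>p\<in>Q b. d p * f p) = (\<Sum>p\<in>Q b. \<Sum>j\<in>Tb b. - (e j * (l b p (Y j) * f p)))"
        proof (rule sum.cong[OF refl])
          fix p assume p: "p \<in> Q b"
          then have "p div r = b" "p \<notin> T" using Q(1)[OF b] b by (auto simp: T_def P_def)
          then show "d p * f p = (\<Sum>j\<in>Tb b. - (e j * (l b p (Y j) * f p)))"
            by (simp add: d_def sum_distrib_left sum_negf mult_ac)
        qed
        also have "\<dots> = (\<Sum>j\<in>Tb b. - (e j * (\<Sum>p\<in>Q b. l b p (Y j) * f p)))"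
          by (subst sum.swap) (simp add: sum_distrib_left sum_negf)
        finally have Q_sum: "(\<Sum>p\<in>Q b. d p * f p) = \<dots>" .
        have "(\<Sum>j\<in>{j\<in>S. j div r = b}. d j * f j) = (\<Sum>p\<in>Q b. d p * f p) + (\<Sum>j\<in>Tb b. d j * f j)"
          unfolding split_b[OF b] using Q_fin[OF b] Tb_fin Q_disj[OF b] by (simp add: sum.union_disjoint)
        also have "\<dots> = (\<Sum>j\<in>Tb b. e j * (f j - (\<Sum>p\<in>Q b. l b p (Y j) * f p)))"
          unfolding Q_sum sum.distrib[symmetric]
          by (intro sum.cong) (auto simp: Tb_def d_def right_diff_distrib)
        finally show ?thesis .
      qed
      have low: "(\<Sum>j\<in>{j\<in>S. j div r = b}. d j * Y j ^ k) = 0" if "k < a" for k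
        unfolding d_sum using l_eq[OF b that] by (simp add: mult.commute[of "l _ _ _"])
      have "(\<Sum>j\<in>{j\<in>S. j div r = b}. d j * B j) = (\<Sum>j\<in>Tb b. e j * u j)"
        unfolding d_sum by (intro sum.cong) (auto simp: u_def Tb_def)
      also have "\<dots> = 0" using 0 by (simp add: Tb_def)
      finally have "(\<Sum>k<h. (\<Sum>j\<in>{j\<in>S. j div r = b}. d j * Y j ^ (a + k)) * w k) = 0"
        by (subst (asm) B_def, subst (asm) \<beta>_def, unfold sum_distrib_left sum_distrib_right)
           (subst sum.swap, simp add: Y_def mult_ac)
      \<comment> \<open>The coefficient of each \<open>w k\<close> lies in \<open>F\<close>, so
        independence of \<open>w\<close> splits one equation over \<open>K\<close> into the power
        sums with exponents \<open>a, ..., a + h - 1\<close>.\<close>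
      then have high: "\<forall>k<h. (\<Sum>j\<in>{j\<in>S. j div r = b}. d j * Y j ^ (a + k)) = 0"
        by (rule w_indep[rotated])
           (use d_F split_b[OF b] in \<open>auto intro!: F.closed Y_F\<close>)
      have "d j0 = 0"
      \<comment> \<open>The power sums with all exponents below \<open>a + h\<close> vanish, and the
        group has at most \<open>a + h\<close> columns.\<close>
      proof (rule vandermonde_cols[OF _ Y_inj card_Sb[OF b]])
        fix k assume "k < a + h"
        then show "(\<Sum>j\<in>{j\<in>S. j div r = b}. d j * Y j ^ k) = 0"
          using low high[rule_format, of "k - a"] by (cases "k < a") auto
      qed (use fin j0 TS b_def in auto)
      then show "e j0 = 0" using j0 by (simp add: d_def)
    qed
  qed
  have "c p = 0" if "p \<in> S" "p \<notin> T" for p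
  proof -
    have b: "p div r < g" using grp that by blast
    have p: "p \<in> Q (p div r)" using that P_iff[OF b] by (auto simp: T_def)
    show ?thesis
      by (subst c_elim[OF b p]) (use c_T in \<open>auto simp: Tb_def intro!: sum.neutral\<close>)
  qed
  then show ?thesis using c_T by blast
qed

text \<open>Choosing \<open>a\<close> columns in every group and enlarging the choice to
  \<open>g * a + h\<close> columns gives a square submatrix. Its columns are independent, hence so
  are its rows.\<close>

lemma H_rows_independent:
  assumes zero: "\<And>j. j < g * r \<Longrightarrow> (\<Sum>i<g * a + h. c i * H i j) = 0"
  shows "\<forall>i<g * a + h. c i = 0"
proof -
  define A where "A b = (\<lambda>k. b * r + k) ` {..<a}" for b
  define S0 where "S0 = (\<Union>b<g. A b)"
  have S0_b: "A b \<subseteq> {j. j div r = b \<and> j < g * r}" if "b < g" for b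
  proof -
    have "b * r + k < g * r" if "k < r" for k
      using that \<open>b < g\<close> mult_le_mono1[of "Suc b" g r] by simp
    then show ?thesis using a_less_r by (auto simp: A_def)
  qed
  have A: "card (A b) = a" "finite (A b)" for b by (simp_all add: A_def card_image)
  have "card S0 = (\<Sum>b<g. card (A b))"
    unfolding S0_def
  proof (rule card_UN_disjoint)
    show "\<forall>b\<in>{..<g}. \<forall>b'\<in>{..<g}. b \<noteq> b' \<longrightarrow> A b \<inter> A b' = {}"
      using S0_b by blast
  qed (simp_all add: A)
  also have "\<dots> = g * a" by (simp add: A)
  finally have "card S0 = g * a" .
  moreover have "S0 \<subseteq> {..<g * r}" unfolding S0_def using S0_b by auto
  ultimately obtain S where S: "S0 \<subseteq> S" "S \<subseteq> {..<g * r}" "card S = g * a + h"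
    using exists_subset_between[of S0 "g * a + h" "{..<g * r}"] dims by auto
  have S_a: "a \<le> card {j \<in> S. j div r = b}" if "b < g" for b
  proof -
    have "card (A b) \<le> card {j \<in> S. j div r = b}"
      using S S0_b that by (intro card_mono) (auto simp: S0_def intro: finite_subset)
    then show ?thesis by (simp add: A)
  qed
  have "\<forall>i\<in>{..<g * a + h}. c i = 0"
  proof (rule K.square_kernel_transpose[of S _ "\<lambda>j i. H i j"])
    show "finite S" using S by (auto intro: finite_subset)
    show "\<forall>j\<in>S. d j = 0" if "\<forall>i\<in>{..<g * a + h}. (\<Sum>j\<in>S. d j * H i j) = 0" for d
      using that by (intro H_cols_independent S S_a) auto
  qed (use S zero H_K K_finite in auto)
  then show ?thesis by simp
qed

end

section \<open>Encoding subfields as ring records\<close>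

text \<open>Transports the field structure of \<open>K\<close> along a map injective on
  \<open>K\<close>; a finite \<open>K\<close> inside an algebraic closure thus becomes a ring record
  over the natural numbers.\<close>

definition encoded_ring :: "('a::Fields.field \<Rightarrow> 'b) \<Rightarrow> 'a set \<Rightarrow> 'b ring" where
  "encoded_ring f K = \<lparr>carrier = f ` K,
     monoid.mult = (\<lambda>x y. f (inv_into K f x * inv_into K f y)), one = f 1,
     ring.zero = f 0, add = (\<lambda>x y. f (inv_into K f x + inv_into K f y))\<rparr>"

locale field_encoding = field_subset K for K :: "'a::Fields.field set" +
  fixes f :: "'a \<Rightarrow> 'b"
  assumes inj: "inj_on f K"
begin

abbreviation R :: "'b ring" where "R \<equiv> encoded_ring f K"

lemma carrier_R: "carrier R = f ` K" and zero_R: "\<zero>\<^bsub>R\<^esub> = f 0" and one_R: "\<one>\<^bsub>R\<^esub> = f 1"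
  by (simp_all add: encoded_ring_def)

lemma mult_R: "x \<in> K \<Longrightarrow> y \<in> K \<Longrightarrow> f x \<otimes>\<^bsub>R\<^esub> f y = f (x * y)"
  and add_R: "x \<in> K \<Longrightarrow> y \<in> K \<Longrightarrow> f x \<oplus>\<^bsub>R\<^esub> f y = f (x + y)"
  by (simp_all add: encoded_ring_def inj)

lemma f_eq_iff: "x \<in> K \<Longrightarrow> y \<in> K \<Longrightarrow> f x = f y \<longleftrightarrow> x = y"
  using inj by (auto simp: inj_on_def)

lemmas R_simps = carrier_R zero_R one_R mult_R add_R f_eq_iff closed

lemma cring_R: "cring R"
proof (intro cringI abelian_groupI comm_monoidI)
  fix x assume "x \<in> carrier R"
  then obtain u where "x = f u" "u \<in> K" by (auto simp: carrier_R)
  then show "\<exists>y\<in>carrier R. y \<oplus>\<^bsub>R\<^esub> x = \<zero>\<^bsub>R\<^esub>"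
    by (intro bexI[of _ "f (- u)"]) (auto simp: R_simps)
qed (auto simp: R_simps algebra_simps)

lemma field_R: "field R"
proof -
  interpret cring R by (rule cring_R)
  show ?thesis
  proof (rule cring_fieldI2)
    fix x assume "x \<in> carrier R" "x \<noteq> \<zero>\<^bsub>R\<^esub>"
    then obtain u where "x = f u" "u \<in> K" "u \<noteq> 0" by (auto simp: R_simps)
    then show "\<exists>y\<in>carrier R. x \<otimes>\<^bsub>R\<^esub> y = \<one>\<^bsub>R\<^esub>"
      by (intro bexI[of _ "f (inverse u)"]) (auto simp: R_simps)
  qed (simp add: R_simps)
qed

lemma finsum_R:
  assumes "finite I" "\<And>i. i \<in> I \<Longrightarrow> t i \<in> K"
  shows "finsum R (\<lambda>i. f (t i)) I = f (sum t I)"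
proof -
  interpret cring R by (rule cring_R)
  show ?thesis using assms
  proof (induction I rule: finite_induct)
    case (insert i I)
    then show ?case by (subst finsum_insert) (auto simp: R_simps)
  qed (simp add: zero_R)
qed

lemma finsum_mult_R:
  assumes "finite I" "co \<in> I \<rightarrow> carrier R" "\<And>i. i \<in> I \<Longrightarrow> t i \<in> K"
  shows "finsum R (\<lambda>i. co i \<otimes>\<^bsub>R\<^esub> f (t i)) I = f (\<Sum>i\<in>I. inv_into K f (co i) * t i)"
proof -
  interpret cring R by (rule cring_R)
  have co: "inv_into K f (co i) \<in> K" "f (inv_into K f (co i)) = co i" if "i \<in> I" for i
    using assms(2) that by (auto simp: carrier_R Pi_iff intro: inv_into_into f_inv_into_f)
  have "finsum R (\<lambda>i. co i \<otimes>\<^bsub>R\<^esub> f (t i)) I = finsum R (\<lambda>i. f (inv_into K f (co i) * t i)) I"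
    by (rule finsum_cong') (use co assms in \<open>auto simp: R_simps simp flip: mult_R\<close>)
  also have "\<dots> = f (\<Sum>i\<in>I. inv_into K f (co i) * t i)"
    by (rule finsum_R) (use co assms in \<open>auto intro: closed\<close>)
  finally show ?thesis .
qed

text \<open>Decoding the coefficients by the inverse of \<open>f\<close> turns a relation in the
  record into one in the ambient field, where \<open>indep\<close> applies.\<close>

lemma lin_indep_R:
  assumes fin: "finite I" and v: "\<And>i j. i \<in> I \<Longrightarrow> j \<in> J \<Longrightarrow> v i j \<in> K"
    and indep: "\<And>c. \<forall>j\<in>J. (\<Sum>i\<in>I. c i * v i j) = 0 \<Longrightarrow> \<forall>i\<in>I. c i = 0"
  shows "lin_indep R I J (\<lambda>i j. f (v i j))"
  unfolding lin_indep_def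
proof (intro ballI impI)
  fix co i
  assume co: "co \<in> I \<rightarrow> carrier R"
    and 0: "\<forall>j\<in>J. finsum R (\<lambda>i. co i \<otimes>\<^bsub>R\<^esub> f (v i j)) I = \<zero>\<^bsub>R\<^esub>" and i: "i \<in> I"
  have inK: "inv_into K f (co i) \<in> K" if "i \<in> I" for i
    using co that by (auto simp: carrier_R Pi_iff intro: inv_into_into)
  have "\<forall>i\<in>I. inv_into K f (co i) = 0"
  proof (intro indep ballI)
    fix j assume j: "j \<in> J"
    have "f (\<Sum>i\<in>I. inv_into K f (co i) * v i j) = f 0"
      using 0 j co v fin by (subst finsum_mult_R[symmetric]) (auto simp: zero_R)
    then show "(\<Sum>i\<in>I. inv_into K f (co i) * v i j) = 0"
      using inK v j by (subst (asm) f_eq_iff) (auto intro!: closed)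
  qed
  then have "inv_into K f (co i) = 0" using i by blast
  then show "co i = \<zero>\<^bsub>R\<^esub>"
    using co i by (metis PiE carrier_R f_inv_into_f funcset_mem zero_R)
qed

end

section \<open>MDS blocks and maximal recoverability over the encoded field\<close>

context linearized_rs_code
begin

text \<open>A codeword lists the values of a polynomial of degree below \<open>a\<close>; if
  nonzero, it vanishes at no more than \<open>a - 1\<close> of the \<open>r\<close> points.\<close>

lemma MDS_gen_vandermonde:
  assumes "field_encoding K f" and A: "\<And>k c. k < a \<Longrightarrow> c < r \<Longrightarrow> A k c = x c ^ k"
  shows "MDS_gen (encoded_ring f K) a r (\<lambda>k c. f (A k c))"
proof -
  interpret field_encoding K f by fact
  have A_K: "A k c \<in> K" if "k < a" "c < r" for k c
    using A[OF that] x_K[OF that(2)] by (simp add: K.closed)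
  have few_zeros: "\<forall>k<a. d k = 0"
    if "Z \<subseteq> {..<r}" "a \<le> card Z" "\<forall>c\<in>Z. (\<Sum>k<a. d k * x c ^ k) = 0" for d Z
    using that vandermonde_rows[of x Z a d] inj_on_subset[OF x_inj] by blast
  show ?thesis
    unfolding MDS_gen_def
  proof (intro conjI allI ballI impI)
    show "f (A k c) \<in> carrier R" if "k < a" "c < r" for c k
      using A_K[OF that] by (simp add: carrier_R)
    show "lin_indep R {..<a} {..<r} (\<lambda>k c. f (A k c))"
    proof (rule lin_indep_R)
      show "\<forall>i\<in>{..<a}. d i = 0" if "\<forall>j\<in>{..<r}. (\<Sum>i<a. d i * A i j) = 0" for d
        using few_zeros[of "{..<r}" d] that a_less_r by (simp add: A)
    qed (auto intro: A_K)
    fix co assume co: "co \<in> {..<a} \<rightarrow> carrier R" and nz: "\<exists>k<a. co k \<noteq> \<zero>\<^bsub>R\<^esub>"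
    define d where "d k = inv_into K f (co k)" for k
    have d: "d k \<in> K" "f (d k) = co k" if "k < a" for k
      using co that by (auto simp: d_def carrier_R Pi_iff intro: inv_into_into f_inv_into_f)
    have fs: "finsum R (\<lambda>k. co k \<otimes>\<^bsub>R\<^esub> f (A k c)) {..<a} = \<zero>\<^bsub>R\<^esub> \<longleftrightarrow> (\<Sum>k<a. d k * x c ^ k) = 0"
      if c: "c < r" for c
    proof -
      have "finsum R (\<lambda>k. co k \<otimes>\<^bsub>R\<^esub> f (A k c)) {..<a} = f (\<Sum>k<a. d k * A k c)"
        unfolding d_def using A_K c by (intro finsum_mult_R co) auto
      moreover have "(\<Sum>k<a. d k * A k c) \<in> K"
        using d A_K c by (intro K.closed) auto
      ultimately show ?thesis using A c by (simp add: zero_R f_eq_iff K.closed)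
    qed
    define Z where "Z = {c. c < r \<and> (\<Sum>k<a. d k * x c ^ k) = 0}"
    have "card Z < a"
    proof (rule ccontr)
      assume "\<not> card Z < a"
      then have "\<forall>k<a. d k = 0" by (intro few_zeros[of Z]) (auto simp: Z_def)
      then show False using nz d(2) by (metis zero_R)
    qed
    moreover have "{c. c < r \<and> finsum R (\<lambda>k. co k \<otimes>\<^bsub>R\<^esub> f (A k c)) {..<a} \<noteq> \<zero>\<^bsub>R\<^esub>} = {..<r} - Z"
      using fs by (auto simp: Z_def)
    moreover have "card ({..<r} - Z) = r - card Z"
      by (subst card_Diff_subset) (auto simp: Z_def)
    ultimately show "r - a + 1 \<le> card {c. c < r \<and> finsum R (\<lambda>k. co k \<otimes>\<^bsub>R\<^esub> f (A k c)) {..<a} \<noteq> \<zero>\<^bsub>R\<^esub>}"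
      using a_less_r by simp
  qed
qed

lemma MR_LRC_H:
  assumes "field_encoding K f"
  shows "MR_LRC (encoded_ring f K) (r * g) r h a (\<lambda>i j. f (H i j))"
proof -
  interpret field_encoding K f by fact
  have n: "r * g div r = g" "r * g = g * r" using r_pos by simp_all
  show ?thesis
    unfolding MR_LRC_def Let_def n(1)
  proof (intro conjI allI impI)
    show "f (H i j) \<in> carrier R" if "j < r * g" for i j
      using that H_K n(2) by (simp add: carrier_R)
    show "f (H i j) = \<zero>\<^bsub>R\<^esub>" if "i < g * a" "j div r \<noteq> i div a" for i j
      using that by (simp add: H_def zero_R)
    show "lin_indep R {..<g * a + h} {..<r * g} (\<lambda>i j. f (H i j))"
    proof (rule lin_indep_R)
      show "H i j \<in> K" if "j \<in> {..<r * g}" for i j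
        using that n(2) by (intro H_K) simp
      show "\<forall>i\<in>{..<g * a + h}. c i = 0" if "\<forall>j\<in>{..<r * g}. (\<Sum>i<g * a + h. c i * H i j) = 0" for c
        using that H_rows_independent[of c] n(2) by simp
    qed simp
    show "MDS_gen R a r (\<lambda>k c. f (H (b * a + k) (b * r + c)))" if "b < g" for b
      by (rule MDS_gen_vandermonde[OF assms]) (use that in \<open>simp add: H_def block_index\<close>)
    fix S assume S: "S \<subseteq> {..<r * g}" "card S = g * a + h \<and> (\<forall>b<g. a \<le> card {j \<in> S. j div r = b})"
    show "lin_indep R S {..<g * a + h} (\<lambda>j i. f (H i j))"
    proof (rule lin_indep_R)
      show "finite S" using S by (auto intro: finite_subset)
      show "H i j \<in> K" if "j \<in> S" for j i using that S n(2) by (intro H_K) auto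
      show "\<forall>j\<in>S. c j = 0" if "\<forall>i\<in>{..<g * a + h}. (\<Sum>j\<in>S. c j * H i j) = 0" for c
        using that S n(2) by (intro H_cols_independent) auto
    qed
  qed simp
qed

end

section \<open>Choice of the parameters and size of the field\<close>

lemma CHAR_gf2: "CHAR(gf2) = 2"
proof (rule CHAR_eq_posI)
  show "of_nat 2 = (0 :: gf2)"
    unfolding numeral_2_eq_2 of_nat_Suc of_nat_0 by transfer simp
  show "of_nat n \<noteq> (0 :: gf2)" if "n > 0" "n < 2" for n
    using that by (cases "n = 1") auto
qed simp

lemma exists_power_2_between:
  assumes "2 \<le> m"
  obtains e where "e > 0" "m \<le> 2 ^ e" "(2::nat) ^ e < 2 * m"
proof -
  define e where "e = (LEAST e. m \<le> (2::nat) ^ e)"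
  have ex: "m \<le> (2::nat) ^ m" by (simp add: less_imp_le)
  have e: "m \<le> 2 ^ e" unfolding e_def by (rule LeastI[of "\<lambda>e. m \<le> (2::nat) ^ e", OF ex])
  then have "e > 0" using assms by (cases e) auto
  then have "\<not> m \<le> 2 ^ (e - 1)" unfolding e_def by (intro not_less_Least) simp
  then have "(2::nat) ^ e < 2 * m" using \<open>e > 0\<close> by (cases e) auto
  then show ?thesis using that e \<open>e > 0\<close> by blast
qed

lemma field_size_bound:
  fixes q g r h a :: nat
  assumes "q \<le> max (2 * r) (4 * g)" "2 \<le> r" "0 < g" "0 < h"
  shows "q ^ h \<le> max (4 * g) ((2 * r) ^ (h + a)) ^ min h g"
proof (cases "h \<le> g")
  case True
  have "2 * r \<le> (2 * r) ^ (h + a)" using assms by (intro self_le_power) auto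
  then have "q ^ h \<le> max (4 * g) ((2 * r) ^ (h + a)) ^ h" using assms by (intro power_mono) auto
  then show ?thesis using True by (simp add: min_def)
next
  case False
  \<comment> \<open>Since \<open>r \<ge> 2\<close>, the base \<open>2 * r\<close> is at least 4, and
    its \<open>g\<close>-th power absorbs the term linear in \<open>g\<close>.\<close>
  have "4 * g \<le> 4 ^ g" using assms(3)
  proof (induction g rule: nat_induct_non_zero)
    case (Suc n)
    then show ?case using one_le_power[of "4::nat" n] by simp
  qed simp
  also have "4 ^ g \<le> (2 * r) ^ g" using assms by (intro power_mono) auto
  finally have "q \<le> (2 * r) ^ g"
    using assms self_le_power[of "2 * r" g] by simp
  then have "q ^ h \<le> ((2 * r) ^ g) ^ h" by (intro power_mono) auto
  also have "\<dots> = ((2 * r) ^ h) ^ g" by (metis mult.commute power_mult)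
  also have "\<dots> \<le> ((2 * r) ^ (h + a)) ^ g"
    using assms by (intro power_mono power_increasing) auto
  also have "\<dots> \<le> max (4 * g) ((2 * r) ^ (h + a)) ^ g" by (intro power_mono) auto
  finally show ?thesis using False by (simp add: min_def)
qed

lemma geometric_sum_nat: "q \<ge> 1 \<Longrightarrow> q ^ h = Suc ((q - 1) * (\<Sum>s<h. q ^ s))" for q :: nat
proof (induction h)
  case (Suc h)
  have "q ^ Suc h = q ^ h + (q - 1) * q ^ h" using Suc.prems by (simp add: algebra_simps diff_mult_distrib)
  then show ?case using Suc by (simp add: algebra_simps)
qed simp

text \<open>\<open>F\<close> must supply \<open>r\<close> evaluation points and \<open>g\<close>
  distinct norms. Norms of nonzero elements are nonzero, which is why \<open>g < q\<close> is
  strict.\<close>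

lemma exists_linearized_rs_code:
  fixes a r g h e :: nat
  defines "q \<equiv> 2 ^ e" and "F \<equiv> fixed_points (2 ^ e) :: 'a::alg_closed_field set"
    and "K \<equiv> fixed_points ((2 ^ e) ^ h) :: 'a set"
  assumes char: "CHAR('a) = 2" and "0 < r" "0 < h" "g * a + h < g * r"
    and "0 < e" and "r \<le> q" and "g < q"
  obtains x w \<gamma> where "linearized_rs_code q F K a r g h x w \<gamma>"
proof -
  have q: "q > 1" unfolding q_def by (rule one_less_power) (use \<open>0 < e\<close> in auto)
  have qh: "q ^ h > 1" by (rule one_less_power[OF q \<open>0 < h\<close>])
  have K_eq: "K = fixed_points (q ^ h)" and F_eq: "F = fixed_points q"
    by (simp_all add: K_def F_def q_def)
  have frob: "(u + v) ^ 2 ^ i = u ^ 2 ^ i + v ^ 2 ^ i" for u v :: 'a and i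
    by (rule freshmans_dream') (simp_all add: char)
  interpret frobenius q F
    by unfold_locales (use q frob in \<open>auto simp: F_eq q_def\<close>)
  have K: "field_subset K"
    unfolding K_eq q_def power_mult[symmetric] by (rule field_subset_fixed_points) (auto intro: frob)
  interpret K: field_subset K by (rule K)
  have F_card: "finite F" "card F = q"
    unfolding F_eq using q char \<open>0 < e\<close> by (auto intro!: card_fixed_points simp: q_def)
  have K_card: "finite K" "card K = q ^ h"
    unfolding K_eq using qh char \<open>0 < e\<close> \<open>0 < h\<close>
    by (auto intro!: card_fixed_points simp: q_def)
  have FK: "F \<subseteq> K"
  proof
    fix u assume u: "u \<in> F"
    have "u ^ q ^ i = u" for i using u by (induction i) (simp_all add: F_iff power_mult)
    then show "u \<in> K" by (simp add: K_eq fixed_points_def)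
  qed
  obtain x where x: "x ` {..<r} \<subseteq> F" "inj_on x {..<r}"
    using card_le_inj[of "{..<r}" F] F_card \<open>r \<le> q\<close> by auto
  have KF: "card K = card F ^ h" using F_card K_card by simp
  obtain w where w: "\<And>k. k < h \<Longrightarrow> w k \<in> K"
    "\<And>c. (\<forall>k<h. c k \<in> F) \<Longrightarrow> (\<Sum>k<h. c k * w k) = 0 \<Longrightarrow> \<forall>k<h. c k = 0"
  proof (rule exists_basis[OF F.field_subset_axioms F_card(1) K K_card(1) KF])
    fix w
    assume "\<And>k. k < h \<Longrightarrow> w k \<in> K"
      "\<And>c. (\<forall>k<h. c k \<in> F) \<Longrightarrow> (\<Sum>k<h. c k * w k) = 0 \<Longrightarrow> \<forall>k<h. c k = 0"
    then show thesis by (rule that)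
  qed
  \<comment> \<open>\<open>N\<close> equals \<open>(q^h - 1) / (q - 1)\<close>, the exponent of the
    norm map from \<open>K\<close> to \<open>F\<close>.\<close>
  define N where "N = (\<Sum>s<h. q ^ s)"
  have "N \<ge> (\<Sum>s<h. 1)" unfolding N_def using q by (intro sum_mono) auto
  then have N: "N > 0" using \<open>0 < h\<close> by simp
  have qN: "q ^ h = Suc ((q - 1) * N)" unfolding N_def by (rule geometric_sum_nat) (use q in simp)
  have "card {..<g} \<le> card (F - {0})" using F_card F.zero_closed \<open>g < q\<close> by simp
  then obtain c where c: "c ` {..<g} \<subseteq> F - {0}" "inj_on c {..<g}"
    using card_le_inj[of "{..<g}" "F - {0}"] F_card(1) by blast
  \<comment> \<open>An element of norm \<open>c b\<close> is taken as a root in the algebraically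
    closed field. For \<open>b < g\<close> it lies in \<open>K\<close>: its power to
    \<open>q^h - 1\<close> is \<open>c b ^ (q - 1)\<close>, which is 1.\<close>
  have "\<exists>y. y ^ N = c b" for b by (rule nth_root_exists[OF N])
  then obtain \<gamma> where \<gamma>: "\<And>b. \<gamma> b ^ N = c b" by metis
  have \<gamma>_K: "\<gamma> b \<in> K - {0}" if b: "b < g" for b
  proof -
    have cb: "c b \<noteq> 0" "c b \<in> F" using c b by auto
    then have "\<gamma> b \<noteq> 0" using \<gamma>[of b] N by (auto simp: power_0_left)
    have "c b * c b ^ (q - 1) = c b"
      using cb q by (simp add: F_iff flip: power_Suc)
    then have "c b ^ (q - 1) = 1" using cb by simp
    then have "\<gamma> b ^ ((q - 1) * N) = 1" by (subst mult.commute) (simp add: power_mult \<gamma>)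
    then show ?thesis using \<open>\<gamma> b \<noteq> 0\<close> by (simp add: K_eq fixed_points_def qN)
  qed
  have \<gamma>_ineq: "b = b'"
    if b: "b < g" "b' < g" and z: "z \<in> K" "z \<noteq> 0" and eq: "\<gamma> b * z ^ (q - 1) = \<gamma> b'" for b b' z
  proof -
    \<comment> \<open>A \<open>(q - 1)\<close>-th power of a nonzero element of \<open>K\<close> has
      norm 1, so equivalent \<open>\<gamma>\<close>'s have equal norms.\<close>
    have "z * z ^ ((q - 1) * N) = z" using z by (simp add: K_eq fixed_points_def qN)
    then have "z ^ ((q - 1) * N) = 1" using z by simp
    then have "c b = (\<gamma> b * z ^ (q - 1)) ^ N"
      by (simp add: power_mult_distrib \<gamma> flip: power_mult)
    then have "c b = c b'" unfolding eq \<gamma> .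
    then show ?thesis using c(2) b by (auto simp: inj_on_def)
  qed
  have "linearized_rs_code q F K a r g h x w \<gamma>"
  proof unfold_locales
    show "\<forall>k<h. d k = 0" if "\<forall>k<h. d k \<in> F" "(\<Sum>k<h. d k * w k) = 0" for d
      using that by (rule w(2))
    show "b = b'" if "b < g" "b' < g" "z \<in> K" "z \<noteq> 0" "\<gamma> b * z ^ (q - 1) = \<gamma> b'" for b b' z
      using that by (rule \<gamma>_ineq)
    show "x i \<in> F" if "i < r" for i using x(1) that by auto
  qed (use K_card(1) FK x(2) w(1) \<gamma>_K assms(5-7) in \<open>simp_all\<close>)
  then show ?thesis by (rule that)
qed

theorem theorem3p12:
  shows "\<exists>C::real. \<exists>c::nat. C > 0 \<and>
    (\<forall>a r h g :: nat. 0 < a \<and> 0 < r \<and> 0 < h \<and> 0 < g \<and> g*a + h < g*r \<longrightarrow>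
      (\<exists>(R :: nat ring) H. field R \<and> finite (carrier R) \<and>
         real (card (carrier R)) \<le>
           (max (C * real g * (ln (real g + 2)) ^ c) ((2 * real r) ^ (h + a))) ^ (min h g) \<and>
         MR_LRC R (r*g) r h a H))"
\<comment> \<open>The exponent 0 makes the logarithmic factor 1. The constant 4 comes from
  \<open>2 * (g + 1) \<le> 4 * g\<close>.\<close>
proof (intro exI[of _ "4::real"] exI[of _ "0::nat"] conjI allI impI)
  fix a r h g :: nat
  assume *: "0 < a \<and> 0 < r \<and> 0 < h \<and> 0 < g \<and> g * a + h < g * r"
  have "r \<ge> 2"
  proof (rule ccontr)
    assume "\<not> r \<ge> 2"
    then have "g * r \<le> g * a" using * by (intro mult_le_mono2) auto
    then show False using * by linarith
  qed
  then have "2 \<le> max r (g + 1)" by simp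
  \<comment> \<open>The two lower bounds on \<open>q\<close> give \<open>r\<close> distinct points
    and \<open>g\<close> nonzero norms in \<open>F\<close>.\<close>
  then obtain e where e: "e > 0" "max r (g + 1) \<le> 2 ^ e" "(2::nat) ^ e < 2 * max r (g + 1)"
    by (rule exists_power_2_between)
  \<comment> \<open>The algebraic closure of the field with two elements is one type containing
    \<open>F\<close> and \<open>K\<close> for all parameters.\<close>
  define F where "F = (fixed_points (2 ^ e) :: gf2 alg_closure set)"
  define K where "K = (fixed_points ((2 ^ e) ^ h) :: gf2 alg_closure set)"
  obtain x w \<gamma> where "linearized_rs_code (2 ^ e) F K a r g h x w \<gamma>"
    using exists_linearized_rs_code[where ?'a = "gf2 alg_closure" and a = a and r = r and h = h and g = g and e = e] e *
    by (auto simp: CHAR_gf2 F_def K_def)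
  then interpret linearized_rs_code "2 ^ e" F K a r g h x w \<gamma> .
  have "1 < (2::nat) ^ (e * h)" by (rule one_less_power) (use e(1) * in auto)
  then have "card K = (2 ^ e) ^ h"
    unfolding K_def using e(1) * by (intro card_fixed_points) (auto simp: CHAR_gf2 power_mult)
  moreover have "2 ^ e \<le> max (2 * r) (4 * g)"
    using e(3) * by (simp add: max_def split: if_splits)
  then have "(2 ^ e) ^ h \<le> max (4 * g) ((2 * r) ^ (h + a)) ^ min h g"
    using * \<open>r \<ge> 2\<close> by (intro field_size_bound) auto
  ultimately have "real (card K) \<le> real (max (4 * g) ((2 * r) ^ (h + a)) ^ min h g)"
    by (metis of_nat_le_iff)
  then have card: "real (card K) \<le>
      max (4 * real g * ln (real g + 2) ^ 0) ((2 * real r) ^ (h + a)) ^ min h g"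
    by (simp add: of_nat_max)
  obtain f :: "gf2 alg_closure \<Rightarrow> nat" where f: "inj_on f K"
    using finite_imp_inj_to_nat_seg[OF K_finite] by blast
  interpret field_encoding K f by unfold_locales (rule f)
  show "\<exists>(R :: nat ring) H. field R \<and> finite (carrier R) \<and>
      real (card (carrier R)) \<le>
        max (4 * real g * ln (real g + 2) ^ 0) ((2 * real r) ^ (h + a)) ^ min h g \<and>
      MR_LRC R (r * g) r h a H"
    using field_R MR_LRC_H[OF field_encoding_axioms] K_finite card
    by (intro exI[of _ "encoded_ring f K"] exI[of _ "\<lambda>i j. f (H i j)"])
       (auto simp: carrier_R card_image[OF f])
qed simp

end
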